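(* Let $T$ be a nonsingular rank-one transformation on $[0,1)$ with the Euclidean metric $d$ and Lebesgue measure $\lambda$, obtained by a cutting and stacking construction in which column $C_n$ is divided into $r_n$ subcolumns with proportions $p_n(0),\ldots,p_n(r_n-1)$. If there exists $c>0$ such that $p_n(j)\ge c$ for all $n$ and all $j\in\{0,\ldots,r_n-1\}$, then $T$ is not restricted sensitive.
   Context: Restricted sensitivity: a measurable nonsingular transformation $T$ of a probability space $(X,\mu)$ with metric $d$ is restricted sensitive if for $\mu$-a.e. $x\in X$ there exist $\delta>0$ and $a>0$ such that for every $\varepsilon>0$ there exists an integer $n\ge 0$ with $n\le -a\log\mu(B_\varepsilon(x))$ and $\mu\{y\in B_\varepsilon(x): d(T^nx,T^ny)>\delta\}>0$. Here $B_\varepsilon(x)$ is the open ball and $\log$ the natural logarithm. Nonsingular rank-one transformations (cutting and stacking): A column is a finite ordered collection of disjoint intervals in $\mathbb{R}$ (its levels, possibly of different lengths); its height is the number of levels. Its column map is defined on all levels except the top one, mapping each level to the next by the unique orientation-preserving affine map. A rank-one nonsingular transformation is specified by integers $r_n\ge 2$, functions $s_n:\{0,\ldots,r_n-1\}\to\mathbb{N}_0$, and probability vectors $p_n$ on $\{0,\ldots,r_n-1\}$, for $n\ge 0$. The column $C_0$ is a single interval. Given $C_n=\{I_{n,i}\}_{i=0}^{h_n-1}$ of height $h_n$ with column map $T_n$ (so $T_n(I_{n,i})=I_{n,i+1}$ for $i\ne h_n-1$), cut each level $I_{n,i}$ into $r_n$ subintervals $I_{n,i}^{[0]},\ldots,I_{n,i}^{[r_n-1]}$,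 from left to right, whose lengths are in the proportions $p_n(0):p_n(1):\cdots:p_n(r_n-1)$; the subcolumns are $C_n^{[j]}=\{I_{n,i}^{[j]}\}_{i=0}^{h_n-1}$, $0\le j\le r_n-1$. Above each subcolumn $C_n^{[j]}$ place $s_n(j)$ new intervals (spacer levels, disjoint from everything so far), each of the same length as the top sublevel of $C_n^{[j]}$. Then stack the resulting subcolumns with spacers, right on top of left, to obtain the column $C_{n+1}$ of height $h_{n+1}=r_nh_n+\sum_{j=0}^{r_n-1}s_n(j)$; its column map $T_{n+1}$ extends $T_n$. It is assumed that the maximal length of the levels of $C_n$ tends to $0$ as $n\to\infty$. $X$ is the union of all levels of all columns (here $X=[0,1)$), and $T(x)=\lim_{n\to\infty}T_n(x)$, which is well-defined and invertible a.e., nonsingular and ergodic. *)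

theory Defs
  imports "HOL-Analysis.Analysis"
begin

text \<open>
  The balls are those of the metric subspace \<open>space M\<close>.  Although
  \<open>ln 0 = 0\<close> in HOL, balls of measure zero need no special treatment: for them
  the second conjunct is false in any case.  Nonsingularity of \<open>T\<close> is not a
  conjunct, so that the negation of this predicate has its full strength.
\<close>

definition restricted_sensitive :: "'a::metric_space measure \<Rightarrow> ('a \<Rightarrow> 'a) \<Rightarrow> bool" where
  "restricted_sensitive M T \<longleftrightarrow>
     (AE x in M. \<exists>\<delta>>0. \<exists>a>0. \<forall>\<epsilon>>0. \<exists>n::nat.
        real n \<le> - a * ln (measure M (ball x \<epsilon> \<inter> space M)) \<and>
        emeasure M {y \<in> ball x \<epsilon> \<inter> space M. dist ((T ^^ n) x) ((T ^^ n) y) > \<delta>} > 0)"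

text \<open>
  The pair \<open>(a, b)\<close> stands for the half-open interval \<open>[a, b)\<close>; cutting an
  interval of this kind gives intervals of the same kind.  A column is listed from
  bottom to top.
\<close>

type_synonym interval = "real \<times> real"
type_synonym column = "interval list"

definition level :: "interval \<Rightarrow> real set" where
  "level I = {fst I..<snd I}"

definition len :: "interval \<Rightarrow> real" where
  "len I = snd I - fst I"

definition is_column :: "column \<Rightarrow> bool" where
  "is_column C \<longleftrightarrow> C \<noteq> [] \<and> (\<forall>I\<in>set C. fst I < snd I) \<and>
     (\<forall>i<length C. \<forall>j<length C. i \<noteq> j \<longrightarrow> level (C ! i) \<inter> level (C ! j) = {})"

definition affine_map :: "interval \<Rightarrow> interval \<Rightarrow> real \<Rightarrow> real" where
  "affine_map I J x = fst J + (x - fst I) * (len J / len I)"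

fun column_map :: "column \<Rightarrow> real \<Rightarrow> real" where
  "column_map (I # J # C) x =
     (if x \<in> level I then affine_map I J x else column_map (J # C) x)"
| "column_map [I] x = undefined"
| "column_map [] x = undefined"

definition prob_vector :: "nat \<Rightarrow> (nat \<Rightarrow> real) \<Rightarrow> bool" where
  "prob_vector r p \<longleftrightarrow> (\<forall>j<r. 0 \<le> p j) \<and> (\<Sum>j<r. p j) = 1"

definition cut :: "(nat \<Rightarrow> real) \<Rightarrow> nat \<Rightarrow> interval \<Rightarrow> interval" where
  "cut p j I = (fst I + len I * (\<Sum>k<j. p k), fst I + len I * (\<Sum>k\<le>j. p k))"

text \<open>
  \<open>S j\<close> lists the spacers put above the \<open>j\<close>-th subcolumn.  That they are disjoint
  from one another and from all earlier levels is expressed by \<open>is_column C'\<close>,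
  because the sublevels of \<open>C\<close> cover every earlier level.
\<close>

definition cut_and_stack ::
    "nat \<Rightarrow> (nat \<Rightarrow> nat) \<Rightarrow> (nat \<Rightarrow> real) \<Rightarrow> column \<Rightarrow> column \<Rightarrow> bool" where
  "cut_and_stack r s p C C' \<longleftrightarrow> is_column C' \<and>
     (\<exists>S. (\<forall>j<r. length (S j) = s j \<and> (\<forall>J\<in>set (S j). len J = len (cut p j (last C)))) \<and>
          C' = concat (map (\<lambda>j. map (cut p j) C @ S j) [0..<r]))"

definition cutting_and_stacking ::
    "(nat \<Rightarrow> nat) \<Rightarrow> (nat \<Rightarrow> nat \<Rightarrow> nat) \<Rightarrow> (nat \<Rightarrow> nat \<Rightarrow> real) \<Rightarrow> (nat \<Rightarrow> column) \<Rightarrow> bool" where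
  "cutting_and_stacking r s p C \<longleftrightarrow>
     (\<forall>n. r n \<ge> 2 \<and> prob_vector (r n) (p n)) \<and>
     is_column (C 0) \<and> length (C 0) = 1 \<and>
     (\<forall>n. cut_and_stack (r n) (s n) (p n) (C n) (C (Suc n))) \<and>
     (\<lambda>n. Max (len ` set (C n))) \<longlonglongrightarrow> 0"

definition total_space :: "(nat \<Rightarrow> column) \<Rightarrow> real set" where
  "total_space C = (\<Union>n. \<Union>I\<in>set (C n). level I)"

text \<open>
  A point of the total space that lies below the top level of \<open>C n\<close> does so for all
  later columns as well, so the value of \<open>column_map\<close> outside its domain
  does not affect the limit.  Only the values of \<open>T\<close> almost everywhere are prescribed.
\<close>

definition rank_one_transformation :: "(nat \<Rightarrow> column) \<Rightarrow> (real \<Rightarrow> real) \<Rightarrow> bool" where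
  "rank_one_transformation C T \<longleftrightarrow>
     (AE x in lebesgue_on (total_space C). (\<lambda>n. column_map (C n) x) \<longlonglongrightarrow> T x)"

end

theory Submission
  imports Defs
begin

text \<open>
  As long as a small ball inside a level of a column has not reached the top, it is carried
  affinely from level to level, so its images are as short as levels are.  Restricted sensitivity
  allows only a time that is logarithmic in the measure of the ball.  Since
  all cutting proportions are at least \<open>c\<close>, every level of \<open>C n\<close> has length at least a
  constant times \<open>c ^ n\<close> (\<open>len_ge\<close>).  A ball filling a fixed proportion of such a level
  therefore gets a time bound of order \<open>n\<close>, while the height of \<open>C n\<close> is at least
  \<open>2 ^ n\<close> (\<open>height_ge\<close>).  For large \<open>n\<close> such a ball violates sensitivity, provided that its centre
  is not close to the top of the column.

  It remains to find a set of positive measure whose points meet these two conditions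
  (centre of the ball away from both ends of the level, many levels left above) for infinitely
  many columns.  The leftmost sublevels of \<open>C n\<close> lie in the lower half of \<open>C (Suc n)\<close>,
  so their middle halves will do; they make up at least the proportion \<open>c / 2\<close> of
  \<open>C n\<close>, and the columns cover increasing sets.  The limit superior of these sets,
  \<open>recurring_set\<close>, thus has positive measure by continuity from above
  (\<open>emeasure_limsup_ge\<close>, \<open>emeasure_recurring_set_pos\<close>).  Every point of it whose orbit obeys the columns is insensitive
  (\<open>recurring_point_insensitive\<close>), and almost every point is of this kind
  (\<open>AE_follows_columns\<close>).  So sensitivity fails on a set of positive measure, which is enough.
\<close>

section \<open>Null sets and limits superior of sets\<close>

lemma AE_lebesgue_affine:
  fixes a b :: real
  assumes "AE z in lebesgue. P z" "b \<noteq> 0"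
  shows "AE x in lebesgue. P (a + b * x)"
proof -
  have "negligible {z. \<not> P z}"
    using assms(1) by (simp add: completion.AE_iff_null_sets negligible_iff_null_sets)
  then have "negligible ((\<lambda>z. (z - a) * inverse b) ` {z. \<not> P z})"
    by (intro negligible_differentiable_image_negligible)
      (auto intro!: derivative_intros simp: differentiable_on_def)
  moreover have "{x. \<not> P (a + b * x)} \<subseteq> (\<lambda>z. (z - a) * inverse b) ` {z. \<not> P z}"
  proof
    fix x assume "x \<in> {x. \<not> P (a + b * x)}"
    then show "x \<in> (\<lambda>z. (z - a) * inverse b) ` {z. \<not> P z}"
      using assms(2) by (intro image_eqI[of _ _ "a + b * x"]) simp_all
  qed
  ultimately have "negligible {x. \<not> P (a + b * x)}"
    by (rule negligible_subset)
  then show ?thesis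
    by (simp add: completion.AE_iff_null_sets negligible_iff_null_sets)
qed

text \<open>
  Continuity from above: the tails
  \<open>\<Union>m\<in>{n..}. A m\<close> decrease to the limit superior and each has measure at least \<open>\<kappa>\<close>.
\<close>

lemma emeasure_limsup_ge:
  fixes A :: "nat \<Rightarrow> 'a set"
  assumes "\<And>n. A n \<in> sets M" "\<And>n. emeasure M (A n) \<ge> \<kappa>" "emeasure M (\<Union>n. A n) \<noteq> \<infinity>"
  shows "emeasure M (\<Inter>n. \<Union>m\<in>{n..}. A m) \<ge> \<kappa>"
proof -
  let ?B = "\<lambda>n. \<Union>m\<in>{n..}. A m"
  have "emeasure M (?B n) \<le> emeasure M (\<Union>n. A n)" for n
    by (rule emeasure_mono) (use assms(1) in auto)
  then have fin: "emeasure M (?B n) \<noteq> \<infinity>" for n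
    using assms(3) by (metis infinity_ennreal_def top.extremum_unique)
  have "(\<lambda>n. emeasure M (?B n)) \<longlonglongrightarrow> emeasure M (\<Inter>n. ?B n)"
  proof (rule Lim_emeasure_decseq)
    show "range ?B \<subseteq> sets M" using assms(1) by auto
    show "decseq ?B" by (force simp: decseq_def)
  qed (rule fin)
  moreover have "\<kappa> \<le> emeasure M (?B n)" for n
    by (rule order_trans[OF assms(2) emeasure_mono[of "A n"]]) (use assms(1) in auto)
  ultimately show ?thesis
    by (intro LIMSEQ_le_const) auto
qed

section \<open>Levels, cuts and columns\<close>

lemma affine_map_mem_level:
  assumes "len I > 0" "len J > 0" "x \<in> level I"
  shows "affine_map I J x \<in> level J"
proof -
  let ?t = "(x - fst I) / len I"
  have t: "0 \<le> ?t" "?t < 1"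
    using assms by (auto simp: level_def len_def divide_simps)
  have "affine_map I J x = fst J + ?t * len J"
    by (simp add: affine_map_def)
  moreover have "0 \<le> ?t * len J" "?t * len J < len J"
    using t mult_strict_right_mono[OF t(2) assms(2)] assms(2) by (simp_all del: times_divide_eq_left)
  ultimately show ?thesis
    by (simp add: level_def len_def)
qed

lemma affine_map_compose:
  assumes "len J \<noteq> 0"
  shows "affine_map J K (affine_map I J x) = affine_map I K x"
  using assms by (simp add: affine_map_def)

lemma affine_map_self:
  assumes "len I \<noteq> 0"
  shows "affine_map I I x = x"
  using assms by (simp add: affine_map_def)

lemma len_cut: "len (cut p j I) = len I * p j"
proof -
  have "(\<Sum>k\<le>j. p k) = (\<Sum>k<j. p k) + p j"
    by (simp add: lessThan_Suc_atMost[symmetric])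
  then show ?thesis
    by (simp add: cut_def len_def algebra_simps)
qed

lemma level_cut_subset:
  assumes "prob_vector r p" "j < r" "0 \<le> len I"
  shows "level (cut p j I) \<subseteq> level I"
proof -
  have "0 \<le> (\<Sum>k<j. p k)"
    using assms by (intro sum_nonneg) (auto simp: prob_vector_def)
  then have "0 \<le> len I * (\<Sum>k<j. p k)"
    using assms(3) by simp
  moreover have "(\<Sum>k\<le>j. p k) \<le> (\<Sum>k<r. p k)"
    using assms by (intro sum_mono2) (auto simp: prob_vector_def)
  then have "len I * (\<Sum>k\<le>j. p k) \<le> len I * 1"
    using assms by (intro mult_left_mono) (auto simp: prob_vector_def)
  ultimately show ?thesis
    by (auto simp: level_def cut_def len_def)
qed

lemma level_cut_cover:
  assumes "prob_vector r p" "x \<in> level I"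
  obtains j where "j < r" "x \<in> level (cut p j I)"
proof -
  let ?f = "\<lambda>j. fst I + len I * (\<Sum>k<j. p k)"
  have top: "x < ?f r"
    using assms by (simp add: prob_vector_def level_def len_def)
  define j where "j = (LEAST j. x < ?f j)"
  have j: "x < ?f j"
    unfolding j_def using top by (rule LeastI)
  have "j \<noteq> 0"
    using j assms(2) by (intro notI) (simp add: level_def)
  then obtain i where i: "j = Suc i"
    by (cases j) auto
  have "\<not> x < ?f i"
    using i not_less_Least[of i "\<lambda>j. x < ?f j"] by (simp add: j_def)
  moreover have "i < r"
    using top i Least_le[of "\<lambda>j. x < ?f j" r] by (simp add: j_def)
  ultimately show thesis
    using j i by (intro that[of i]) (auto simp: level_def cut_def lessThan_Suc_atMost)
qed

lemma AE_affine_map: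
  assumes "AE z in lebesgue. P z" "len I \<noteq> 0" "len J \<noteq> 0"
  shows "AE x in lebesgue. P (affine_map I J x)"
proof -
  have "affine_map I J x = fst J - fst I * (len J / len I) + len J / len I * x" for x
    unfolding affine_map_def by algebra
  then show ?thesis
    using AE_lebesgue_affine[OF assms(1), of "len J / len I" "fst J - fst I * (len J / len I)"]
      assms(2,3) by simp
qed

text \<open>
  Cutting scales both intervals by the same factor; this is why the later column maps extend the
  earlier ones.
\<close>

lemma affine_map_cut:
  assumes "p j \<noteq> 0" "len I \<noteq> 0"
  shows "affine_map (cut p j I) (cut p j J) x = affine_map I J x"
  using assms unfolding affine_map_def len_cut by (simp add: cut_def field_simps)

lemma is_column_len_pos:
  assumes "is_column C" "I \<in> set C"
  shows "len I > 0"
  using assms by (auto simp: is_column_def len_def)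

lemma is_column_Cons_Cons:
  assumes "is_column (I # J # C)"
  shows "is_column (J # C)"
  unfolding is_column_def
proof (intro conjI allI impI ballI)
  fix i j assume "i < length (J # C)" "j < length (J # C)" "i \<noteq> j"
  then have "level ((I # J # C) ! Suc i) \<inter> level ((I # J # C) ! Suc j) = {}"
    using assms unfolding is_column_def
    by (metis Suc_inject Suc_less_eq length_Cons)
  then show "level ((J # C) ! i) \<inter> level ((J # C) ! j) = {}" by simp
qed (use assms in \<open>auto simp: is_column_def\<close>)

lemma column_map_nth:
  assumes "is_column C" "Suc i < length C" "x \<in> level (C ! i)"
  shows "column_map C x = affine_map (C ! i) (C ! Suc i) x"
  using assms
proof (induction C arbitrary: i rule: induct_list012)
  case (3 I J C)
  show ?case
  proof (cases i)
    case 0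
    then show ?thesis using "3.prems" by simp
  next
    case (Suc k)
    have "level ((I # J # C) ! 0) \<inter> level ((I # J # C) ! i) = {}"
      using "3.prems" Suc unfolding is_column_def by (metis Suc_lessD nat.simps(3) zero_less_Suc length_Cons)
    then have "x \<notin> level I"
      using "3.prems"(3) by auto
    moreover have "column_map (J # C) x = affine_map ((J # C) ! k) ((J # C) ! Suc k) x"
      using "3.prems" Suc by (intro "3.IH"(2) is_column_Cons_Cons[OF "3.prems"(1)]) auto
    ultimately show ?thesis
      using Suc by simp
  qed
qed simp_all

section \<open>One step of cutting and stacking\<close>

lemma cut_and_stack_subcolumn:
  assumes "cut_and_stack r s p C C'" "j < r"
  obtains A B where "C' = A @ map (cut p j) C @ B"
proof -
  obtain S where "C' = concat (map (\<lambda>j. map (cut p j) C @ S j) [0..<r])"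
    using assms(1) by (auto simp: cut_and_stack_def)
  moreover have "[0..<r] = [0..<j] @ j # [Suc j..<r]"
    using assms(2) upt_add_eq_append[of 0 j "r - j"] by (simp add: upt_conv_Cons)
  ultimately show thesis
    by (intro that[of "concat (map (\<lambda>j. map (cut p j) C @ S j) [0..<j])"
          "S j @ concat (map (\<lambda>j. map (cut p j) C @ S j) [Suc j..<r])"]) simp
qed

text \<open>
  The second copy of the column gives the points of the leftmost subcolumn room to move: they are
  at least a full height below the top of the new column.
\<close>

lemma cut_and_stack_bottom:
  assumes "cut_and_stack r s p C C'" "2 \<le> r"
  shows "2 * length C \<le> length C'" "i < length C \<Longrightarrow> C' ! i = cut p 0 (C ! i)"
proof -
  obtain S where "C' = concat (map (\<lambda>j. map (cut p j) C @ S j) [0..<r])"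
    using assms(1) by (auto simp: cut_and_stack_def)
  moreover have "[0..<r] = 0 # 1 # [2..<r]"
    using assms(2) by (simp add: upt_conv_Cons numeral_2_eq_2)
  ultimately have C': "C' = map (cut p 0) C @ S 0 @ map (cut p 1) C @ S 1 @
      concat (map (\<lambda>j. map (cut p j) C @ S j) [2..<r])"
    by simp
  show "2 * length C \<le> length C'" unfolding C' by simp
  show "C' ! i = cut p 0 (C ! i)" if "i < length C"
    unfolding C' using that by (simp add: nth_append)
qed

text \<open>
  A spacer is as long as the sublevel below it, so it obeys the same lower bound as the sublevels.
\<close>

lemma cut_and_stack_len_ge:
  assumes "cut_and_stack r s p C C'" "is_column C" "\<forall>j<r. c \<le> p j" "0 \<le> c"
    and \<beta>: "\<forall>I\<in>set C. \<beta> \<le> len I" and "J \<in> set C'"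
  shows "c * \<beta> \<le> len J"
proof -
  obtain S where C': "C' = concat (map (\<lambda>j. map (cut p j) C @ S j) [0..<r])"
    and S: "\<forall>j<r. \<forall>J\<in>set (S j). len J = len (cut p j (last C))"
    using assms(1) by (auto simp: cut_and_stack_def)
  obtain j where j: "j < r" "J \<in> set (map (cut p j) C @ S j)"
    using assms(6) unfolding C' by auto
  have "\<exists>I\<in>set C. len J = len (cut p j I)"
    using j S assms(2) by (force simp: is_column_def)
  then obtain I where I: "I \<in> set C" "len J = len I * p j"
    by (auto simp: len_cut)
  have "\<beta> * c \<le> len I * c"
    using \<beta> I assms(4) by (intro mult_right_mono) auto
  also have "\<dots> \<le> len I * p j"
    using assms(3) j(1) is_column_len_pos[OF assms(2) I(1)] by (intro mult_left_mono) auto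
  finally show ?thesis
    using I(2) by (simp add: mult.commute)
qed

lemma cut_and_stack_level_subset:
  assumes "cut_and_stack r s p C C'" "prob_vector r p"
  shows "(\<Union>I\<in>set C. level I) \<subseteq> (\<Union>I\<in>set C'. level I)"
proof
  fix x assume "x \<in> (\<Union>I\<in>set C. level I)"
  then obtain I where I: "I \<in> set C" "x \<in> level I" by auto
  obtain j where j: "j < r" "x \<in> level (cut p j I)"
    using level_cut_cover[OF assms(2) I(2)] .
  obtain A B where "C' = A @ map (cut p j) C @ B"
    using cut_and_stack_subcolumn[OF assms(1) j(1)] .
  then show "x \<in> (\<Union>I\<in>set C'. level I)"
    using I j by auto
qed

lemma cut_and_stack_affine_map:
  assumes cs: "cut_and_stack r s p C C'" and pv: "prob_vector r p" and C: "is_column C"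
    and i: "Suc i < length C" and x: "x \<in> level (C ! i)"
  obtains i' where "Suc i' < length C'" "x \<in> level (C' ! i')"
    "affine_map (C' ! i') (C' ! Suc i') x = affine_map (C ! i) (C ! Suc i) x"
proof -
  obtain j where j: "j < r" "x \<in> level (cut p j (C ! i))"
    using level_cut_cover[OF pv x] .
  obtain A B where C': "C' = A @ map (cut p j) C @ B"
    using cut_and_stack_subcolumn[OF cs j(1)] .
  have nth: "C' ! (length A + k) = cut p j (C ! k)" if "k < length C" for k
    using that by (simp add: C' nth_append)
  have pos: "len (C ! i) > 0"
    using C i by (intro is_column_len_pos[OF C]) simp
  have "cut p j (C ! i) \<in> set C'"
    using i by (auto simp: C')
  then have "len (cut p j (C ! i)) > 0"
    using cs by (auto simp: cut_and_stack_def intro: is_column_len_pos)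
  then have "p j \<noteq> 0"
    by (auto simp: len_cut)
  then have "affine_map (cut p j (C ! i)) (cut p j (C ! Suc i)) x = affine_map (C ! i) (C ! Suc i) x"
    using pos by (intro affine_map_cut) auto
  with nth[of i] nth[of "Suc i"] i j show thesis
    by (intro that[of "length A + i"]) (auto simp: C')
qed

section \<open>Columns of a cutting and stacking construction\<close>

lemma cutting_and_stackingD:
  assumes "cutting_and_stacking r s p C"
  shows "2 \<le> r n" "prob_vector (r n) (p n)" "is_column (C n)"
    "cut_and_stack (r n) (s n) (p n) (C n) (C (Suc n))"
proof -
  show "2 \<le> r n" "prob_vector (r n) (p n)"
    "cut_and_stack (r n) (s n) (p n) (C n) (C (Suc n))"
    using assms by (auto simp: cutting_and_stacking_def)
  show "is_column (C n)"
    using assms by (cases n) (auto simp: cutting_and_stacking_def cut_and_stack_def)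
qed

lemma height_ge:
  assumes "cutting_and_stacking r s p C"
  shows "2 ^ n \<le> length (C n)"
proof (induction n)
  case 0
  then show ?case using assms by (simp add: cutting_and_stacking_def)
next
  case (Suc n)
  then show ?case
    using cut_and_stack_bottom(1)[OF cutting_and_stackingD(4,1)[OF assms, of n]] by simp
qed

lemma len_bottom_pos:
  assumes "cutting_and_stacking r s p C"
  shows "0 < len (C 0 ! 0)"
  using assms unfolding cutting_and_stacking_def by (intro is_column_len_pos[of "C 0"]) auto

lemma len_ge:
  assumes "cutting_and_stacking r s p C" "0 \<le> c" "\<forall>n. \<forall>j<r n. c \<le> p n j"
  shows "\<forall>I\<in>set (C n). c ^ n * len (C 0 ! 0) \<le> len I"
proof (induction n)
  case 0
  have "length (C 0) = 1"
    using assms(1) by (simp add: cutting_and_stacking_def)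
  then show ?case by (cases "C 0") auto
next
  case (Suc n)
  show ?case
  proof
    fix J assume "J \<in> set (C (Suc n))"
    then have "c * (c ^ n * len (C 0 ! 0)) \<le> len J"
      using cut_and_stack_len_ge[OF cutting_and_stackingD(4,3)[OF assms(1), of n] _ assms(2) Suc]
        assms(3) by auto
    then show "c ^ Suc n * len (C 0 ! 0) \<le> len J"
      by (simp add: mult.assoc)
  qed
qed

lemma sets_total_space [simp]: "total_space C \<in> sets lebesgue"
  unfolding total_space_def
  by (intro sets.countable_UN sets.finite_UN image_subsetI) (auto simp: level_def)

lemma level_subset_total_space:
  assumes "i < length (C m)"
  shows "level (C m ! i) \<subseteq> total_space C"
  using nth_mem[OF assms] unfolding total_space_def by blast

text \<open>
  The covered sets increase, so the single level of \<open>C 0\<close> bounds the measure of every column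
  from below.
\<close>

lemma level_bottom_subset:
  assumes "cutting_and_stacking r s p C"
  shows "level (C 0 ! 0) \<subseteq> (\<Union>I\<in>set (C n). level I)"
proof (induction n)
  case 0
  have "C 0 ! 0 \<in> set (C 0)"
    using assms by (simp add: cutting_and_stacking_def)
  then show ?case by auto
next
  case (Suc n)
  then show ?case
    using cut_and_stack_level_subset[OF cutting_and_stackingD(4,2)[OF assms, of n]] by blast
qed

lemma column_map_extends:
  assumes cs: "cutting_and_stacking r s p C"
    and "m \<le> n" "Suc i < length (C m)" "x \<in> level (C m ! i)"
  shows "column_map (C n) x = affine_map (C m ! i) (C m ! Suc i) x"
proof -
  have "\<exists>i'. Suc i' < length (C n) \<and> x \<in> level (C n ! i') \<and>
      affine_map (C n ! i') (C n ! Suc i') x = affine_map (C m ! i) (C m ! Suc i) x"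
    using \<open>m \<le> n\<close>
  proof (induction n rule: dec_induct)
    case base
    then show ?case using assms by auto
  next
    case (step n)
    then obtain i' where i': "Suc i' < length (C n)" "x \<in> level (C n ! i')"
      "affine_map (C n ! i') (C n ! Suc i') x = affine_map (C m ! i) (C m ! Suc i) x"
      by auto
    show ?case
      using cut_and_stack_affine_map[OF cutting_and_stackingD(4,2,3)[OF cs] i'(1,2)] i'(3)
      by metis
  qed
  then show ?thesis
    using column_map_nth[OF cutting_and_stackingD(3)[OF cs]] by metis
qed

section \<open>Iterates of the transformation\<close>

lemma AE_T_eq_affine_map:
  assumes cs: "cutting_and_stacking r s p C" and T: "rank_one_transformation C T"
  shows "AE x in lebesgue. \<forall>m i. Suc i < length (C m) \<and> x \<in> level (C m ! i) \<longrightarrow>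
           T x = affine_map (C m ! i) (C m ! Suc i) x"
proof -
  have "AE x in lebesgue. x \<in> total_space C \<longrightarrow> (\<lambda>n. column_map (C n) x) \<longlonglongrightarrow> T x"
    using T by (simp add: rank_one_transformation_def AE_restrict_space_iff)
  then show ?thesis
  proof (rule AE_mp, intro AE_I2 impI allI)
    fix x m i
    assume lim: "x \<in> total_space C \<longrightarrow> (\<lambda>n. column_map (C n) x) \<longlonglongrightarrow> T x"
      and i: "Suc i < length (C m) \<and> x \<in> level (C m ! i)"
    have "x \<in> total_space C"
      using i level_subset_total_space[of i C m] by auto
    moreover have "\<forall>\<^sub>F n in sequentially. column_map (C n) x = affine_map (C m ! i) (C m ! Suc i) x"
      using column_map_extends[OF cs] i by (intro eventually_sequentiallyI[of m]) auto
    then have "(\<lambda>n. column_map (C n) x) \<longlonglongrightarrow> affine_map (C m ! i) (C m ! Suc i) x"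
      by (rule tendsto_eventually)
    ultimately show "T x = affine_map (C m ! i) (C m ! Suc i) x"
      using lim LIMSEQ_unique by blast
  qed
qed

text \<open>
  The columns prescribe \<open>T\<close> only up to a null set, so iterating it needs that the
  affine maps between levels pull null sets back to null sets.
\<close>

lemma AE_funpow_eq_affine_map:
  assumes cs: "cutting_and_stacking r s p C" and T: "rank_one_transformation C T"
    and "i + k < length (C m)"
  shows "AE x in lebesgue. x \<in> level (C m ! i) \<longrightarrow> (T ^^ k) x = affine_map (C m ! i) (C m ! (i + k)) x"
  using assms(3)
proof (induction k)
  case 0
  have "len (C m ! i) > 0"
    using 0 by (intro is_column_len_pos[OF cutting_and_stackingD(3)[OF cs, of m]]) auto
  then show ?case by (simp add: affine_map_self)
next
  case (Suc k)
  let ?I = "C m ! i" and ?J = "C m ! (i + k)" and ?K = "C m ! (i + Suc k)"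
  have pos: "len ?I > 0" "len ?J > 0"
    using Suc.prems by (auto intro!: is_column_len_pos[OF cutting_and_stackingD(3)[OF cs]] nth_mem)
  have "AE z in lebesgue. z \<in> level ?J \<longrightarrow> T z = affine_map ?J ?K z"
    using AE_T_eq_affine_map[OF cs T] by (rule AE_mp) (use Suc.prems in auto)
  then have "AE x in lebesgue. affine_map ?I ?J x \<in> level ?J \<longrightarrow>
      T (affine_map ?I ?J x) = affine_map ?J ?K (affine_map ?I ?J x)"
    by (rule AE_affine_map) (use pos in auto)
  moreover have "AE x in lebesgue. x \<in> level ?I \<longrightarrow> (T ^^ k) x = affine_map ?I ?J x"
    using Suc by simp
  ultimately show ?case
    by eventually_elim (use pos in \<open>auto simp: affine_map_compose affine_map_mem_level\<close>)
qed

definition follows_columns :: "(nat \<Rightarrow> column) \<Rightarrow> (real \<Rightarrow> real) \<Rightarrow> real \<Rightarrow> bool" where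
  "follows_columns C T x \<longleftrightarrow> (\<forall>m i k. i + k < length (C m) \<and> x \<in> level (C m ! i) \<longrightarrow>
     (T ^^ k) x \<in> level (C m ! (i + k)))"

lemma AE_follows_columns:
  assumes cs: "cutting_and_stacking r s p C" and T: "rank_one_transformation C T"
  shows "AE x in lebesgue. follows_columns C T x"
proof -
  have "AE x in lebesgue. i + k < length (C m) \<and> x \<in> level (C m ! i) \<longrightarrow>
          (T ^^ k) x \<in> level (C m ! (i + k))" for m i k
  proof (cases "i + k < length (C m)")
    case True
    have "len (C m ! i) > 0" "len (C m ! (i + k)) > 0"
      using True by (auto intro!: is_column_len_pos[OF cutting_and_stackingD(3)[OF cs]] nth_mem)
    with AE_funpow_eq_affine_map[OF cs T True] show ?thesis
      by (elim AE_mp) (auto simp: affine_map_mem_level)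
  qed simp
  then show ?thesis
    unfolding follows_columns_def by (simp only: AE_all_countable) blast
qed

section \<open>Recurring points\<close>

text \<open>
  Balls whose radius is a quarter of the length, centred at these points, still fit into the level.
\<close>

definition middle_half :: "interval \<Rightarrow> real set" where
  "middle_half I = {fst I + len I / 4 <..< snd I - len I / 4}"

text \<open>
  The sublevels with index \<open>0\<close> form the leftmost subcolumn, which is stacked below all
  others: its points have a whole copy of the column still above them.
\<close>

definition core :: "(nat \<Rightarrow> real) \<Rightarrow> column \<Rightarrow> real set" where
  "core p C = (\<Union>I\<in>set C. middle_half (cut p 0 I))"

lemma ball_subset_level:
  assumes "x \<in> middle_half I"
  shows "ball x (len I / 4) \<subseteq> level I"
proof
  fix y assume "y \<in> ball x (len I / 4)"
  then have "\<bar>x - y\<bar> < len I / 4"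
    by (simp add: dist_real_def)
  then show "y \<in> level I"
    using assms unfolding middle_half_def level_def greaterThanLessThan_iff atLeastLessThan_iff
    by linarith
qed

lemma middle_half_subset_level:
  assumes "0 \<le> len I"
  shows "middle_half I \<subseteq> level I"
  using assms by (auto simp: middle_half_def level_def)

lemma emeasure_middle_half:
  assumes "0 \<le> len I"
  shows "emeasure lebesgue (middle_half I) = ennreal (len I / 2)"
proof -
  have "snd I - len I / 4 - (fst I + len I / 4) = len I / 2"
    unfolding len_def by argo
  then show ?thesis
    using assms by (simp add: middle_half_def)
qed

lemma emeasure_level:
  assumes "0 \<le> len I"
  shows "emeasure lebesgue (level I) = ennreal (len I)"
  using assms by (simp add: level_def len_def)

text \<open>
  The middle half of the leftmost sublevel takes up the proportion \<open>p 0 / 2\<close> of each level.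
\<close>

lemma emeasure_core_ge:
  assumes C: "is_column C" and pv: "prob_vector r p" and "0 < r" and c: "0 \<le> c" "c \<le> p 0"
    and K: "level K \<subseteq> (\<Union>I\<in>set C. level I)" "0 \<le> len K"
  shows "ennreal (c / 2 * len K) \<le> emeasure lebesgue (core p C)"
proof -
  let ?F = "\<lambda>i. middle_half (cut p 0 (C ! i))"
  have pos: "len (C ! i) > 0" if "i < length C" for i
    using that by (intro is_column_len_pos[OF C]) simp
  have cut_nonneg: "0 \<le> len (cut p 0 (C ! i))" if "i < length C" for i
    using pos[OF that] c by (simp add: len_cut)
  have sub: "?F i \<subseteq> level (C ! i)" if "i < length C" for i
    using middle_half_subset_level[OF cut_nonneg[OF that]]
      level_cut_subset[OF pv \<open>0 < r\<close>, of "C ! i"] pos[OF that] by force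
  have disj: "disjoint_family_on ?F {..<length C}"
    unfolding disjoint_family_on_def
  proof (intro ballI impI)
    fix i j assume "i \<in> {..<length C}" "j \<in> {..<length C}" "i \<noteq> j"
    moreover from this have "level (C ! i) \<inter> level (C ! j) = {}"
      using C by (auto simp: is_column_def)
    ultimately show "?F i \<inter> ?F j = {}"
      using sub[of i] sub[of j] by auto
  qed
  have "ennreal (len K) \<le> emeasure lebesgue (\<Union>i<length C. level (C ! i))"
    unfolding emeasure_level[OF K(2), symmetric]
    using K(1) by (intro emeasure_mono) (auto simp: level_def set_conv_nth Bex_def)
  also have "\<dots> \<le> (\<Sum>i<length C. emeasure lebesgue (level (C ! i)))"
    by (intro emeasure_subadditive_finite) (auto simp: level_def)
  also have "\<dots> = (\<Sum>i<length C. ennreal (len (C ! i)))"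
    by (intro sum.cong refl emeasure_level less_imp_le pos) simp
  finally have total: "ennreal (len K) \<le> (\<Sum>i<length C. ennreal (len (C ! i)))" .
  have "ennreal (c / 2 * len K) = ennreal (c / 2) * ennreal (len K)"
    using c K(2) by (intro ennreal_mult) auto
  also have "\<dots> \<le> ennreal (c / 2) * (\<Sum>i<length C. ennreal (len (C ! i)))"
    by (intro mult_left_mono total) simp
  also have "\<dots> = (\<Sum>i<length C. ennreal (c / 2 * len (C ! i)))"
    unfolding sum_distrib_left using c pos
    by (intro sum.cong refl ennreal_mult[symmetric]) (auto simp: less_imp_le)
  also have "\<dots> \<le> (\<Sum>i<length C. emeasure lebesgue (?F i))"
  proof (intro sum_mono)
    fix i assume "i \<in> {..<length C}"
    then have i: "i < length C" by simp
    have "c / 2 * len (C ! i) \<le> len (cut p 0 (C ! i)) / 2"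
      using mult_right_mono[OF c(2), of "len (C ! i)"] pos[OF i] by (simp add: len_cut mult.commute)
    then show "ennreal (c / 2 * len (C ! i)) \<le> emeasure lebesgue (?F i)"
      unfolding emeasure_middle_half[OF cut_nonneg[OF i]] by (rule ennreal_leI)
  qed
  also have "\<dots> = emeasure lebesgue (\<Union>i<length C. ?F i)"
    by (intro sum_emeasure disj) (auto simp: middle_half_def)
  also have "(\<Union>i<length C. ?F i) = core p C"
    by (force simp: core_def set_conv_nth)
  finally show ?thesis .
qed

lemma core_memE:
  assumes cs: "cutting_and_stacking r s p C" and "x \<in> core (p m) (C m)"
  obtains i where "i < length (C m)" "x \<in> middle_half (C (Suc m) ! i)"
    "2 * length (C m) \<le> length (C (Suc m))"
proof -
  obtain i where "i < length (C m)" "x \<in> middle_half (cut (p m) 0 (C m ! i))"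
    using assms(2) by (auto simp: core_def in_set_conv_nth)
  then show thesis
    using cut_and_stack_bottom[OF cutting_and_stackingD(4,1)[OF cs, of m]]
    by (intro that) auto
qed

lemma core_subset_total_space:
  assumes cs: "cutting_and_stacking r s p C"
  shows "core (p m) (C m) \<subseteq> total_space C"
proof
  fix x assume "x \<in> core (p m) (C m)"
  then obtain i where i: "i < length (C m)" "x \<in> middle_half (C (Suc m) ! i)"
    "2 * length (C m) \<le> length (C (Suc m))"
    using core_memE[OF cs] by metis
  then have "0 < len (C (Suc m) ! i)"
    by (intro is_column_len_pos[OF cutting_and_stackingD(3)[OF cs, of "Suc m"]]) simp
  then show "x \<in> total_space C"
    using middle_half_subset_level[of "C (Suc m) ! i"] level_subset_total_space[of i C "Suc m"] i
    by auto
qed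

definition recurring_set :: "(nat \<Rightarrow> nat \<Rightarrow> real) \<Rightarrow> (nat \<Rightarrow> column) \<Rightarrow> real set" where
  "recurring_set p C = (\<Inter>n. \<Union>m\<in>{n..}. core (p m) (C m))"

lemma emeasure_recurring_set_pos:
  assumes cs: "cutting_and_stacking r s p C" and X: "emeasure lebesgue (total_space C) \<noteq> \<infinity>"
    and "\<exists>c>0. \<forall>n. \<forall>j<r n. p n j \<ge> c"
  shows "emeasure lebesgue (recurring_set p C) > 0"
proof -
  obtain c where c: "0 < c" "\<forall>n. \<forall>j<r n. c \<le> p n j"
    using assms(3) by auto
  have L: "0 < len (C 0 ! 0)"
    by (rule len_bottom_pos[OF cs])
  have "ennreal (c / 2 * len (C 0 ! 0)) \<le> emeasure lebesgue (recurring_set p C)"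
    unfolding recurring_set_def
  proof (rule emeasure_limsup_ge)
    show "core (p m) (C m) \<in> sets lebesgue" for m
      by (auto simp: core_def middle_half_def)
    show "ennreal (c / 2 * len (C 0 ! 0)) \<le> emeasure lebesgue (core (p m) (C m))" for m
      using cutting_and_stackingD[OF cs, of m] c L level_bottom_subset[OF cs]
      by (intro emeasure_core_ge[where r = "r m"]) auto
    have "emeasure lebesgue (\<Union>m. core (p m) (C m)) \<le> emeasure lebesgue (total_space C)"
      using core_subset_total_space[OF cs] sets_total_space[of C]
      by (intro emeasure_mono) auto
    then show "emeasure lebesgue (\<Union>m. core (p m) (C m)) \<noteq> \<infinity>"
      using X by (auto simp: top_unique)
  qed
  moreover have "0 < ennreal (c / 2 * len (C 0 ! 0))"
    using c(1) L by simp
  ultimately show ?thesis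
    by (rule less_le_trans[rotated])
qed

section \<open>Failure of restricted sensitivity\<close>

lemma eventually_linear_less_power:
  fixes a K D :: real
  shows "\<forall>\<^sub>F n in sequentially. a * (real n * K + D) < 2 ^ n"
proof -
  have "(\<lambda>n. real n / 2 ^ n) \<longlonglongrightarrow> 0" "(\<lambda>n. 1 / 2 ^ n :: real) \<longlonglongrightarrow> 0"
    using lim_n_over_pown[of "2::real"] LIMSEQ_divide_realpow_zero[of 2 1] by simp_all
  then have "(\<lambda>n. a * (real n / 2 ^ n * K + 1 / 2 ^ n * D)) \<longlonglongrightarrow> a * (0 * K + 0 * D)"
    by (intro tendsto_intros)
  then have "\<forall>\<^sub>F n in sequentially. a * (real n / 2 ^ n * K + 1 / 2 ^ n * D) < 1"
    by (rule order_tendstoD) simp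
  then show ?thesis
    by (rule eventually_mono) (simp add: field_simps)
qed

text \<open>
  The ball around \<open>x\<close> is chosen inside the level \<open>I\<close>
  of \<open>C (Suc m)\<close> that contains \<open>x\<close>, with half the length of \<open>I\<close>.  As levels shrink at most
  by the factor \<open>c\<close> in each step, the time bound is linear in \<open>m\<close>, whereas
  \<open>I\<close> has at least \<open>2 ^ m\<close> levels above it.  So at each time allowed the
  image of the ball lies, up to a null set, in a single level, which is short.
\<close>

lemma recurring_point_insensitive:
  assumes cs: "cutting_and_stacking r s p C" and X: "total_space C = {0..<1}"
    and c: "0 < c" "\<forall>n. \<forall>j<r n. c \<le> p n j"
    and AE: "AE y in lebesgue. follows_columns C T y"
    and x: "x \<in> recurring_set p C" "follows_columns C T x" and "\<delta> > 0" "a > 0"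
  obtains \<epsilon> where "\<epsilon> > 0"
    "\<And>n. real n \<le> - a * ln (measure (lebesgue_on {0..<1}) (ball x \<epsilon> \<inter> {0..<1})) \<Longrightarrow>
      emeasure (lebesgue_on {0..<1})
        {y \<in> ball x \<epsilon> \<inter> {0..<1}. dist ((T ^^ n) x) ((T ^^ n) y) > \<delta>} = 0"
proof -
  define L where "L = len (C 0 ! 0)"
  have "L > 0"
    unfolding L_def by (rule len_bottom_pos[OF cs])
  let ?bound = "\<lambda>m. a * (real m * - ln c + (- ln c - ln (L / 2)))"
  have "\<forall>\<^sub>F m in sequentially. Max (len ` set (C m)) < \<delta>"
    using cs \<open>\<delta> > 0\<close> unfolding cutting_and_stacking_def by (intro order_tendstoD(2)) auto
  then have "\<forall>\<^sub>F m in sequentially. Max (len ` set (C (Suc m))) < \<delta>"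
    by (subst eventually_sequentially_Suc)
  with eventually_linear_less_power[of a "- ln c" "- ln c - ln (L / 2)"]
  have "\<forall>\<^sub>F m in sequentially. ?bound m < 2 ^ m \<and> Max (len ` set (C (Suc m))) < \<delta>"
    by (rule eventually_conj)
  then obtain N where N: "\<And>m. m \<ge> N \<Longrightarrow> ?bound m < 2 ^ m"
    "\<And>m. m \<ge> N \<Longrightarrow> Max (len ` set (C (Suc m))) < \<delta>"
    unfolding eventually_sequentially by auto
  obtain m where m: "m \<ge> N" "x \<in> core (p m) (C m)"
    using x(1) by (auto simp: recurring_set_def)
  obtain i where i: "i < length (C m)" "x \<in> middle_half (C (Suc m) ! i)"
    "2 * length (C m) \<le> length (C (Suc m))"
    using core_memE[OF cs m(2)] .
  define I where "I = C (Suc m) ! i"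
  have I_mem: "I \<in> set (C (Suc m))"
    unfolding I_def using i by simp
  have I_pos: "len I > 0"
    using I_mem by (rule is_column_len_pos[OF cutting_and_stackingD(3)[OF cs]])
  have ball_sub: "ball x (len I / 4) \<subseteq> level I"
    using i(2) ball_subset_level by (simp add: I_def)
  have ball_sub_X: "ball x (len I / 4) \<subseteq> {0..<1}"
    using ball_sub level_subset_total_space[of i C "Suc m"] i X by (auto simp: I_def)
  have x_I: "x \<in> level I"
    using ball_sub I_pos by auto
  have "ball x (len I / 4) \<inter> {0..<1} = {x - len I / 4 <..< x + len I / 4}"
    using ball_sub_X by (auto simp: ball_eq_greaterThanLessThan)
  then have measure_ball: "measure (lebesgue_on {0..<1}) (ball x (len I / 4) \<inter> {0..<1}) = len I / 2"
    using I_pos ball_sub_X by (simp add: measure_restrict_space ball_eq_greaterThanLessThan)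
  have "c ^ Suc m * (L / 2) \<le> len I / 2"
    using len_ge[OF cs less_imp_le[OF c(1)] c(2), of "Suc m"] I_mem by (simp add: L_def)
  then have "ln (c ^ Suc m * (L / 2)) \<le> ln (len I / 2)"
    using c(1) \<open>L > 0\<close> by (intro ln_mono) simp_all
  also have "ln (c ^ Suc m * (L / 2)) = real (Suc m) * ln c + ln (L / 2)"
    using c(1) \<open>L > 0\<close> ln_mult[of "c ^ Suc m" "L / 2"] by (simp only: ln_realpow) simp
  finally have "- ln (measure (lebesgue_on {0..<1}) (ball x (len I / 4) \<inter> {0..<1}))
      \<le> real m * - ln c + (- ln c - ln (L / 2))"
    unfolding measure_ball by (simp add: algebra_simps)
  from mult_left_mono[OF this, of a]
  have bound: "- a * ln (measure (lebesgue_on {0..<1}) (ball x (len I / 4) \<inter> {0..<1})) \<le> ?bound m"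
    using \<open>a > 0\<close> by simp
  show thesis
  proof (rule that)
    show "len I / 4 > 0"
      using I_pos by simp
  next
    fix n assume "real n \<le> - a * ln (measure (lebesgue_on {0..<1}) (ball x (len I / 4) \<inter> {0..<1}))"
    also note bound
    also have "?bound m < real (2 ^ m)"
      using N(1)[OF m(1)] by simp
    finally have "n < 2 ^ m"
      unfolding of_nat_less_iff .
    then have n: "i + n < length (C (Suc m))"
      using height_ge[OF cs, of m] i by linarith
    have close: "dist ((T ^^ n) x) ((T ^^ n) y) \<le> \<delta>"
      if "y \<in> ball x (len I / 4)" "follows_columns C T y" for y
    proof -
      let ?J = "C (Suc m) ! (i + n)"
      have "y \<in> level I"
        using that ball_sub by auto
      then have "(T ^^ n) x \<in> level ?J" "(T ^^ n) y \<in> level ?J"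
        using x(2) that(2) n x_I unfolding follows_columns_def I_def by blast+
      then have "dist ((T ^^ n) x) ((T ^^ n) y) < len ?J"
        by (auto simp: level_def len_def dist_real_def)
      also have "\<dots> \<le> Max (len ` set (C (Suc m)))"
        using n by (intro Max_ge) auto
      finally show ?thesis
        using N(2)[OF m(1)] by simp
    qed
    let ?D = "{y \<in> ball x (len I / 4) \<inter> {0..<1}. dist ((T ^^ n) x) ((T ^^ n) y) > \<delta>}"
    have "?D \<subseteq> {y. \<not> follows_columns C T y}"
      using close by force
    moreover have "{y. \<not> follows_columns C T y} \<in> null_sets lebesgue"
      using AE by (simp add: completion.AE_iff_null_sets)
    ultimately have "?D \<in> null_sets lebesgue"
      by (rule null_sets_completion_subset)
    then show "emeasure (lebesgue_on {0..<1}) ?D = 0"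
      by (subst emeasure_restrict_space) auto
  qed
qed

theorem proposition4p1:
  fixes r :: "nat \<Rightarrow> nat" and s :: "nat \<Rightarrow> nat \<Rightarrow> nat" and p :: "nat \<Rightarrow> nat \<Rightarrow> real"
    and C :: "nat \<Rightarrow> column" and T :: "real \<Rightarrow> real"
  assumes "cutting_and_stacking r s p C"
    and "total_space C = {0..<1}"
    and "rank_one_transformation C T"
    and "\<exists>c>0. \<forall>n. \<forall>j<r n. p n j \<ge> c"
  shows "\<not> restricted_sensitive (lebesgue_on {0..<1}) T"
proof
  assume "restricted_sensitive (lebesgue_on {0..<1}) T"
  then have "AE x in lebesgue. x \<in> {0..<1} \<longrightarrow> (\<exists>\<delta>>0. \<exists>a>0. \<forall>\<epsilon>>0. \<exists>n::nat.
        real n \<le> - a * ln (measure (lebesgue_on {0..<1}) (ball x \<epsilon> \<inter> {0..<1})) \<and>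
        emeasure (lebesgue_on {0..<1})
          {y \<in> ball x \<epsilon> \<inter> {0..<1}. dist ((T ^^ n) x) ((T ^^ n) y) > \<delta>} > 0)"
    unfolding restricted_sensitive_def by (subst (asm) AE_restrict_space_iff) auto
  moreover have follows: "AE x in lebesgue. follows_columns C T x"
    by (rule AE_follows_columns[OF assms(1,3)])
  ultimately have "AE x in lebesgue. x \<notin> recurring_set p C"
  proof eventually_elim
    case (elim x)
    obtain c where c: "0 < c" "\<forall>n. \<forall>j<r n. c \<le> p n j"
      using assms(4) by auto
    show ?case
    proof
      assume x: "x \<in> recurring_set p C"
      then obtain m where "x \<in> core (p m) (C m)"
        by (auto simp: recurring_set_def)
      then have "x \<in> {0..<1}"
        using core_subset_total_space[OF assms(1)] assms(2) by blast
      then obtain \<delta> a where "\<delta> > 0" "a > 0" and sensitive: "\<And>\<epsilon>. \<epsilon> > 0 \<Longrightarrow> \<exists>n::nat.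
        real n \<le> - a * ln (measure (lebesgue_on {0..<1}) (ball x \<epsilon> \<inter> {0..<1})) \<and>
        emeasure (lebesgue_on {0..<1})
          {y \<in> ball x \<epsilon> \<inter> {0..<1}. dist ((T ^^ n) x) ((T ^^ n) y) > \<delta>} > 0"
        using elim(1) by blast
      obtain \<epsilon> where "\<epsilon> > 0" and insensitive:
        "\<And>n. real n \<le> - a * ln (measure (lebesgue_on {0..<1}) (ball x \<epsilon> \<inter> {0..<1})) \<Longrightarrow>
          emeasure (lebesgue_on {0..<1})
            {y \<in> ball x \<epsilon> \<inter> {0..<1}. dist ((T ^^ n) x) ((T ^^ n) y) > \<delta>} = 0"
        using recurring_point_insensitive[OF assms(1,2) c follows x elim(2) \<open>\<delta> > 0\<close> \<open>a > 0\<close>] by blast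
      show False
        using sensitive[OF \<open>\<epsilon> > 0\<close>] insensitive by fastforce
    qed
  qed
  then have "recurring_set p C \<in> null_sets lebesgue"
    by (simp add: completion.AE_iff_null_sets)
  moreover have "emeasure lebesgue (recurring_set p C) > 0"
    using emeasure_recurring_set_pos[OF assms(1) _ assms(4)] assms(2) by simp
  ultimately show False
    by auto
qed

end
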